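(* Let $(\Gamma,\circ)$ be a finite magma and let $\eta$ be a constant with $0\le\eta<1/120$. Let $G$ be a (not necessarily abelian) group with $|G|=|\Gamma|$, with multiplication written $xy$ and identity $e$, and let $f\colon G\to\Gamma$ be a map. Suppose that (a) $\Pr_{x,y\in G}[f(xy)=f(x)\circ f(y)]\ge1-\eta$, where $x,y$ are independent and uniform in $G$; and (b) for every subgroup $H\neq\{e\}$ of $G$ there exist two distinct elements $x,y\in H$ such that $\Pr_{u\in G}[f(xu)=f(yu)]\le1/2$, with $u$ uniform in $G$. Then there exists a binary operation $\ast\colon\Gamma\times\Gamma\to\Gamma$ such that $(\Gamma,\ast)$ is a group isomorphic to $G$ and $\mathrm{Ham}_\Gamma(\circ,\ast)\le46\eta|G|^2$.
   Context: A magma $(\Gamma,\circ)$ is a set with a binary operation $\circ\colon\Gamma\times\Gamma\to\Gamma$. For two binary operations $\circ,\ast$ on the same set $\Gamma$, $\mathrm{Ham}_\Gamma(\circ,\ast)=|\{(x,y)\in\Gamma\times\Gamma : x\circ y\neq x\ast y\}|$. *)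

theory Defs
  imports "HOL-Probability.Probability" "HOL-Algebra.Group"
begin

definition magma :: "'a set \<Rightarrow> ('a \<Rightarrow> 'a \<Rightarrow> 'a) \<Rightarrow> bool" where
  "magma \<Gamma> f \<longleftrightarrow> (\<forall>x\<in>\<Gamma>. \<forall>y\<in>\<Gamma>. f x y \<in> \<Gamma>)"

definition Ham :: "'a set \<Rightarrow> ('a \<Rightarrow> 'a \<Rightarrow> 'a) \<Rightarrow> ('a \<Rightarrow> 'a \<Rightarrow> 'a) \<Rightarrow> nat" where
  "Ham \<Gamma> f g = card {(x, y) \<in> \<Gamma> \<times> \<Gamma>. f x y \<noteq> g x y}"

end

theory Submission
  imports Defs
begin

text \<open>
  Put \<open>N = |G|\<close>, let \<open>E\<close> be the set of pairs violating \<open>f (x y) = f x \<circ> f y\<close>, and let \<open>A z\<close> be the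
  set of \<open>u\<close> with \<open>f (z u) = f u\<close>. If \<open>u \<in> A z\<close> and \<open>v = u w \<notin> A z\<close>, then \<open>(z u, w)\<close> or \<open>(u, w)\<close>
  lies in \<open>E\<close>, so \<open>|A z| (N - |A z|) \<le> 2 |E|\<close>: the density of \<open>A z\<close> is close to 0 or to 1. By this
  gap, the \<open>z\<close> for which \<open>A z\<close> is large form a subgroup, which is trivial by hypothesis (b); hence
  \<open>|A z| \<le> 4 \<eta> N\<close> for \<open>z \<noteq> e\<close>. Two elements \<open>a \<noteq> b\<close> with \<open>f a = f b\<close> for which \<open>E\<close> contains few
  pairs \<open>(a, y)\<close> and few pairs \<open>(b, y)\<close> would make \<open>A (b a\<^sup>-\<^sup>1)\<close> too large. So \<open>f\<close> is injective
  outside a set of at most \<open>3 \<eta> N\<close> elements, and it suffices to transport the multiplication of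
  \<open>G\<close> along a bijection that agrees with \<open>f\<close> off that set.
\<close>

section \<open>Uniform pairs and extension of partial injections\<close>

lemma pair_pmf_of_set:
  assumes "finite A" "A \<noteq> {}" "finite B" "B \<noteq> {}"
  shows "pair_pmf (pmf_of_set A) (pmf_of_set B) = pmf_of_set (A \<times> B)"
proof (rule pmf_eqI)
  fix p
  have "A \<times> B \<noteq> {}" using assms by auto
  then show "pmf (pair_pmf (pmf_of_set A) (pmf_of_set B)) p = pmf (pmf_of_set (A \<times> B)) p"
    using assms
    by (cases p) (simp add: pmf_pair pmf_of_set indicator_def card_cartesian_product
        del: Times_empty)
qed

lemma bij_betw_extending_inj_on:
  assumes "finite A" "finite B" "card A = card B" "f \<in> A \<rightarrow> B" "S \<subseteq> A" "inj_on f S"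
  obtains g where "bij_betw g A B" "\<And>x. x \<in> S \<Longrightarrow> g x = f x"
proof -
  have im: "f ` S \<subseteq> B" using assms by auto
  have "card (A - S) = card (B - f ` S)"
    using assms im by (simp add: card_Diff_subset finite_subset card_image)
  then obtain h where h: "bij_betw h (A - S) (B - f ` S)"
    using assms by (meson finite_Diff finite_same_card_bij)
  define g where "g x = (if x \<in> S then f x else h x)" for x
  have "bij_betw g S (f ` S)"
    using assms by (auto simp: bij_betw_def inj_on_def g_def)
  moreover have "bij_betw g (A - S) (B - f ` S)"
    using h by (rule bij_betw_cong[THEN iffD1, rotated]) (auto simp: g_def)
  ultimately have "bij_betw g (S \<union> (A - S)) (f ` S \<union> (B - f ` S))"
    by (rule bij_betw_combine) auto
  moreover have "S \<union> (A - S) = A" "f ` S \<union> (B - f ` S) = B" using assms im by auto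
  ultimately show ?thesis using that[of g] by (auto simp: g_def)
qed

section \<open>Defect pairs and approximate periods\<close>

context group
begin

text \<open>This is E of the opening comment, with \<open>c\<close> for the magma operation;
  \<open>period_set f z\<close> below is \<open>A z\<close>.\<close>

definition defect :: "('a \<Rightarrow> 'd) \<Rightarrow> ('d \<Rightarrow> 'd \<Rightarrow> 'd) \<Rightarrow> ('a \<times> 'a) set" where
  "defect f c = {(x, y) \<in> carrier G \<times> carrier G. f (x \<otimes> y) \<noteq> c (f x) (f y)}"

definition period_set :: "('a \<Rightarrow> 'd) \<Rightarrow> 'a \<Rightarrow> 'a set" where
  "period_set f z = {u \<in> carrier G. f (z \<otimes> u) = f u}"

lemma finite_defect: "finite (carrier G) \<Longrightarrow> finite (defect f c)"
  by (rule finite_subset[of _ "carrier G \<times> carrier G"]) (auto simp: defect_def)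

lemma finite_period_set: "finite (carrier G) \<Longrightarrow> finite (period_set f z)"
  by (simp add: period_set_def)

lemma period_set_subset: "period_set f z \<subseteq> carrier G"
  by (auto simp: period_set_def)

lemma period_set_one: "period_set f \<one> = carrier G"
  by (auto simp: period_set_def)

lemma period_set_gap:
  assumes fin: "finite (carrier G)" and z: "z \<in> carrier G"
  shows "card (period_set f z) * (card (carrier G) - card (period_set f z))
           \<le> 2 * card (defect f c)"
proof -
  let ?A = "period_set f z" and ?E = "defect f c"
  let ?E' = "{(u, w) \<in> carrier G \<times> carrier G. (z \<otimes> u, w) \<in> ?E}"
  have finE: "finite ?E" using fin by (rule finite_defect)
  have fin': "finite ?E'"
    by (rule finite_subset[of _ "carrier G \<times> carrier G"]) (use fin in auto)
  have "card ?E' \<le> card ?E"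
    by (rule card_inj_on_le[where f = "\<lambda>(u, w). (z \<otimes> u, w)"]) (use z finE in \<open>auto simp: inj_on_def\<close>)
  \<comment> \<open>Put w = \<open>inv u \<otimes> v\<close>. If neither (z u, w) nor (u, w) were a
    defect, then f (z v) = c (f (z u)) (f w) = c (f u) (f w) = f v, against the choice of v.\<close>
  moreover have "card (?A \<times> (carrier G - ?A)) \<le> card (?E' \<union> ?E)"
  proof (rule card_inj_on_le[where f = "\<lambda>(u, v). (u, inv u \<otimes> v)"])
    show "inj_on (\<lambda>(u, v). (u, inv u \<otimes> v)) (?A \<times> (carrier G - ?A))"
      by (auto simp: inj_on_def period_set_def)
    show "(\<lambda>(u, v). (u, inv u \<otimes> v)) ` (?A \<times> (carrier G - ?A)) \<subseteq> ?E' \<union> ?E"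
    proof (clarify del: UnCI, rule UnCI)
      fix u v assume uv: "u \<in> ?A" "v \<in> carrier G" "v \<notin> ?A" "(u, inv u \<otimes> v) \<notin> ?E"
      then have u: "u \<in> carrier G" "f (z \<otimes> u) = f u" "f (z \<otimes> v) \<noteq> f v"
        by (auto simp: period_set_def)
      have "u \<otimes> (inv u \<otimes> v) = v" using u uv by (simp add: m_assoc[symmetric])
      moreover from this have "z \<otimes> u \<otimes> (inv u \<otimes> v) = z \<otimes> v" using u uv z by (simp add: m_assoc)
      ultimately show "(u, inv u \<otimes> v) \<in> ?E'"
        using u uv z by (auto simp: defect_def)
    qed
    show "finite (?E' \<union> ?E)" using fin' finE by simp
  qed
  moreover have "card (?E' \<union> ?E) \<le> card ?E' + card ?E" by (rule card_Un_le)
  moreover have "card (carrier G - ?A) = card (carrier G) - card ?A"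
    using fin by (simp add: card_Diff_subset finite_period_set period_set_subset)
  ultimately show ?thesis by (simp add: card_cartesian_product)
qed

text \<open>If u is in \<open>A w\<close> and w u is in \<open>A z\<close>, then f (z w u) = f (w u)
  = f u. The set \<open>?B\<close> of all u with w u in \<open>A z\<close> is a translate of
  \<open>A z\<close>, so inclusion-exclusion bounds the intersection from below.\<close>

lemma card_period_set_mult:
  assumes fin: "finite (carrier G)" and "z \<in> carrier G" "w \<in> carrier G"
  shows "card (period_set f z) + card (period_set f w)
           \<le> card (period_set f (z \<otimes> w)) + card (carrier G)"
proof -
  let ?A = "period_set f"
  let ?B = "{u \<in> carrier G. w \<otimes> u \<in> ?A z}"
  have finB: "finite ?B" using fin by simp
  have "card (?A z) \<le> card ?B"
    by (rule card_inj_on_le[where f = "\<lambda>u. inv w \<otimes> u"])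
       (use assms finB in \<open>auto simp: inj_on_def period_set_def m_assoc[symmetric]\<close>)
  moreover have "card (?B \<union> ?A w) + card (?B \<inter> ?A w) = card ?B + card (?A w)"
    using card_Un_Int[OF finB finite_period_set[OF fin]] by metis
  moreover have "card (?B \<union> ?A w) \<le> card (carrier G)"
    by (rule card_mono) (use fin in \<open>auto simp: period_set_def\<close>)
  moreover have "card (?B \<inter> ?A w) \<le> card (?A (z \<otimes> w))"
    by (rule card_mono) (use assms in \<open>auto simp: period_set_def m_assoc\<close>)
  ultimately show ?thesis by linarith
qed

lemma card_period_set_inv:
  assumes fin: "finite (carrier G)" and z: "z \<in> carrier G"
  shows "card (period_set f z) \<le> card (period_set f (inv z))"
  by (rule card_inj_on_le[where f = "\<lambda>u. z \<otimes> u"])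
     (use assms in \<open>auto simp: inj_on_def period_set_def m_assoc[symmetric]\<close>)

text \<open>Substituting v = x u turns the event of hypothesis (b) into a condition on the single
  period \<open>y \<otimes> inv x\<close>.\<close>

lemma card_agreement_eq:
  assumes fin: "finite (carrier G)" and "x \<in> carrier G" "y \<in> carrier G"
  shows "card {u \<in> carrier G. f (x \<otimes> u) = f (y \<otimes> u)} = card (period_set f (y \<otimes> inv x))"
proof (rule bij_betw_same_card)
  show "bij_betw (\<lambda>u. x \<otimes> u) {u \<in> carrier G. f (x \<otimes> u) = f (y \<otimes> u)}
          (period_set f (y \<otimes> inv x))"
  proof (rule bij_betwI[where g = "\<lambda>u. inv x \<otimes> u"])
    have "y \<otimes> inv x \<otimes> (x \<otimes> u) = y \<otimes> u" if "u \<in> carrier G" for u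
      using assms that by (simp add: m_assoc inv_solve_left')
    then show "(\<lambda>u. x \<otimes> u) \<in> {u \<in> carrier G. f (x \<otimes> u) = f (y \<otimes> u)}
        \<rightarrow> period_set f (y \<otimes> inv x)"
      using assms by (auto simp: period_set_def)
  qed (use assms in \<open>auto simp: period_set_def m_assoc[symmetric]\<close>)
qed

lemma subgroup_large_period_set:
  fixes f :: "'a \<Rightarrow> 'd"
  assumes fin: "finite (carrier G)"
    and defect: "16 * card (defect f c) < card (carrier G) ^ 2"
  shows "subgroup {z \<in> carrier G. card (carrier G) < 2 * card (period_set f z)} G"
    (is "subgroup ?K G")
proof -
  let ?N = "card (carrier G)" and ?a = "\<lambda>z. card (period_set f z)"
  have N: "?N > 0" using fin by (auto simp: card_gt_0_iff)
  \<comment> \<open>Density above 1/2 improves to above 3/4: otherwise a (N - a) would be at least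
    N^2/8, more than the gap allows. Two densities above 3/4 then leave the product one above
    1/2.\<close>
  have large: "4 * (?N - ?a z) < ?N" if z: "z \<in> ?K" for z
  proof (rule ccontr)
    assume "\<not> ?thesis"
    then have "?N * ?N \<le> (2 * ?a z) * (4 * (?N - ?a z))"
      using z by (intro mult_mono) auto
    also have "\<dots> = 8 * (?a z * (?N - ?a z))" by simp
    also have "\<dots> \<le> 16 * card (defect f c)"
      using period_set_gap[OF fin, of z f c] z by simp
    finally show False using defect by (simp add: power2_eq_square)
  qed
  show ?thesis
  proof
    show "\<one> \<in> ?K" using N by (simp add: period_set_one)
  next
    fix x y assume xy: "x \<in> ?K" "y \<in> ?K"
    then show "x \<otimes> y \<in> ?K"
      using large[OF xy(1)] large[OF xy(2)] card_period_set_mult[OF fin, of x y f] by auto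
  next
    fix x assume "x \<in> ?K"
    then show "inv x \<in> ?K" using card_period_set_inv[OF fin, of x f] by auto
  qed auto
qed

text \<open>If f a = f b, then f (a y) = f (b y) for every y that is a defect with neither a nor b.
  The group is thus covered by two bad rows and one agreement set; the threshold 1/3 makes these
  three too small.\<close>

lemma inj_on_small_row_defect:
  assumes fin: "finite (carrier G)"
    and small: "\<And>z. z \<in> carrier G \<Longrightarrow> z \<noteq> \<one> \<Longrightarrow> 3 * card (period_set f z) \<le> card (carrier G)"
  shows "inj_on f {a \<in> carrier G. 3 * card {y \<in> carrier G. (a, y) \<in> defect f c} < card (carrier G)}"
    (is "inj_on f ?S")
proof (rule inj_onI, rule ccontr)
  fix a b assume ab: "a \<in> ?S" "b \<in> ?S" "f a = f b" "a \<noteq> b"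
  let ?R = "\<lambda>a. {y \<in> carrier G. (a, y) \<in> defect f c}"
  let ?D = "{u \<in> carrier G. f (a \<otimes> u) = f (b \<otimes> u)}"
  have "b \<otimes> inv a \<noteq> \<one>"
    using ab by (metis (mono_tags, lifting) inv_equality inv_inv mem_Collect_eq inv_closed)
  then have D: "3 * card ?D \<le> card (carrier G)"
    using card_agreement_eq[OF fin, of a b f] small[of "b \<otimes> inv a"] ab by simp
  have "card (carrier G) \<le> card (?R a \<union> ?R b \<union> ?D)"
    by (rule card_mono) (use ab fin in \<open>auto simp: defect_def\<close>)
  also have "\<dots> \<le> card (?R a) + card (?R b) + card ?D"
    by (meson card_Un_le add_le_mono order_refl order_trans)
  finally show False using D ab by auto
qed

text \<open>Markov's inequality: the row sizes add up to |E|.\<close>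

lemma card_large_row_defect:
  assumes fin: "finite (carrier G)"
  shows "card (carrier G) *
      card {a \<in> carrier G. card (carrier G) \<le> 3 * card {y \<in> carrier G. (a, y) \<in> defect f c}}
        \<le> 3 * card (defect f c)"
    (is "?N * card ?B \<le> _")
proof -
  let ?R = "\<lambda>a. {y \<in> carrier G. (a, y) \<in> defect f c}"
  have "?N * card ?B = (\<Sum>a\<in>?B. ?N)" by simp
  also have "\<dots> \<le> (\<Sum>a\<in>?B. 3 * card (?R a))" by (rule sum_mono) auto
  also have "\<dots> \<le> (\<Sum>a\<in>carrier G. 3 * card (?R a))" by (rule sum_mono2) (use fin in auto)
  also have "\<dots> = 3 * card (Sigma (carrier G) ?R)"
    using fin by (subst card_SigmaI) (auto simp: sum_distrib_left)
  also have "Sigma (carrier G) ?R = defect f c" by (auto simp: defect_def)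
  finally show ?thesis .
qed

section \<open>Transport of the multiplication, and probabilities as counts\<close>

lemma transported_group:
  assumes g: "bij_betw g (carrier G) X"
  defines "h \<equiv> the_inv_into (carrier G) g"
  defines "H \<equiv> \<lparr>carrier = X, mult = \<lambda>p q. g (h p \<otimes> h q), one = g \<one>\<rparr>"
  shows "group H" "H \<cong> G"
proof -
  have bij: "bij_betw h X (carrier G)" unfolding h_def using g by (rule bij_betw_the_inv_into)
  have hg [simp]: "h (g x) = x" if "x \<in> carrier G" for x
    using g that unfolding h_def by (simp add: bij_betw_def the_inv_into_f_f)
  have gh [simp]: "g (h p) = p" if "p \<in> X" for p
    using g that unfolding h_def by (simp add: bij_betw_def f_the_inv_into_f)
  have cl [simp]: "h p \<in> carrier G" if "p \<in> X" for p
    using bij that by (auto simp: bij_betw_def)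
  have gcl [simp]: "g x \<in> X" if "x \<in> carrier G" for x
    using g that by (auto simp: bij_betw_def)
  show "group H"
  proof (rule groupI)
    fix p assume p: "p \<in> carrier H"
    then show "\<exists>q\<in>carrier H. q \<otimes>\<^bsub>H\<^esub> p = \<one>\<^bsub>H\<^esub>"
      by (intro bexI[of _ "g (inv (h p))"]) (auto simp: H_def)
  qed (auto simp: H_def m_assoc)
  have "h \<in> iso H G" using bij by (auto simp: iso_def hom_def H_def)
  then show "H \<cong> G" by (auto simp: is_iso_def)
qed

text \<open>Pulled back through \<open>g\<close>, a disagreement is a defect pair or has one of x,
  y, x y in \<open>B\<close>. Each of the last three cases accounts for at most N |B| pairs.\<close>

lemma Ham_transported_le:
  assumes fin: "finite (carrier G)" and g: "bij_betw g (carrier G) X"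
    and eq: "\<And>x. x \<in> carrier G - B \<Longrightarrow> g x = f x" and B: "B \<subseteq> carrier G"
  defines "h \<equiv> the_inv_into (carrier G) g"
  shows "Ham X c (\<lambda>p q. g (h p \<otimes> h q)) \<le> card (defect f c) + 3 * (card (carrier G) * card B)"
proof -
  let ?C = "carrier G"
  let ?P = "{(x, y) \<in> ?C \<times> ?C. x \<otimes> y \<in> B}"
  have hg [simp]: "h (g x) = x" if "x \<in> ?C" for x
    using g that unfolding h_def by (simp add: bij_betw_def the_inv_into_f_f)
  have finB: "finite B" using B fin by (rule finite_subset)
  have finP: "finite ?P" by (rule finite_subset[of _ "?C \<times> ?C"]) (use fin in auto)
  have P: "card ?P \<le> card (?C \<times> B)"
    by (rule card_inj_on_le[where f = "\<lambda>(x, y). (x, x \<otimes> y)"])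
       (use fin finB in \<open>auto simp: inj_on_def\<close>)
  let ?U = "defect f c \<union> B \<times> ?C \<union> ?C \<times> B \<union> ?P"
  have finU: "finite ?U" using fin finB finP finite_defect[OF fin, of f c] by simp
  have "{(p, q) \<in> X \<times> X. c p q \<noteq> g (h p \<otimes> h q)} \<subseteq> map_prod g g ` ?U"
  proof clarify
    fix p q assume "p \<in> X" "q \<in> X" and ne: "c p q \<noteq> g (h p \<otimes> h q)"
    then obtain x y where xy: "x \<in> ?C" "y \<in> ?C" "p = g x" "q = g y"
      using g by (auto simp: bij_betw_def)
    then have "c (g x) (g y) \<noteq> g (x \<otimes> y)" using ne by simp
    then have "(x, y) \<in> ?U" using xy eq[of x] eq[of y] eq[of "x \<otimes> y"]
      by (cases "x \<in> B"; cases "y \<in> B"; cases "x \<otimes> y \<in> B") (auto simp: defect_def)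
    then show "(p, q) \<in> map_prod g g ` ?U" using xy by force
  qed
  then have "Ham X c (\<lambda>p q. g (h p \<otimes> h q)) \<le> card (map_prod g g ` ?U)"
    unfolding Ham_def by (intro card_mono finite_imageI finU)
  also have "\<dots> \<le> card ?U" by (rule card_image_le[OF finU])
  also have "\<dots> \<le> card (defect f c) + card (B \<times> ?C) + card (?C \<times> B) + card ?P"
    by (meson card_Un_le add_le_mono order_refl order_trans)
  finally show ?thesis using P by (simp add: card_cartesian_product algebra_simps)
qed

lemma prob_hom_eq:
  assumes fin: "finite (carrier G)"
  shows "measure_pmf.prob (pair_pmf (pmf_of_set (carrier G)) (pmf_of_set (carrier G)))
           {(x, y). f (x \<otimes> y) = c (f x) (f y)}
         = 1 - real (card (defect f c)) / real (card (carrier G)) ^ 2"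
proof -
  let ?C = "carrier G"
  have ne: "?C \<noteq> {}" by auto
  have N: "real (card ?C) > 0" using fin ne by (simp add: card_gt_0_iff)
  have sub: "defect f c \<subseteq> ?C \<times> ?C" by (auto simp: defect_def)
  have "(?C \<times> ?C) \<inter> {(x, y). f (x \<otimes> y) = c (f x) (f y)} = ?C \<times> ?C - defect f c"
    by (auto simp: defect_def)
  moreover have "real (card (?C \<times> ?C - defect f c)) = real (card ?C) ^ 2 - real (card (defect f c))"
    using sub fin by (simp add: card_Diff_subset finite_defect card_mono of_nat_diff
        card_cartesian_product power2_eq_square flip: of_nat_mult)
      (metis card_cartesian_product card_mono finite_cartesian_product of_nat_diff)
  ultimately show ?thesis
    using fin ne N by (simp add: pair_pmf_of_set measure_pmf_of_set card_cartesian_product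
        power2_eq_square field_simps)
qed

end

theorem theorem4:
  fixes \<Gamma> :: "'a set"
    and circ :: "'a \<Rightarrow> 'a \<Rightarrow> 'a"
    and G :: "('b, 'c) monoid_scheme" (structure)
    and f :: "'b \<Rightarrow> 'a"
    and \<eta> :: real
  assumes "magma \<Gamma> circ" and "finite \<Gamma>"
    and "0 \<le> \<eta>" and "\<eta> < 1 / 120"
    and "group G" and "finite (carrier G)" and "card (carrier G) = card \<Gamma>"
    and "f \<in> carrier G \<rightarrow> \<Gamma>"
    and "measure_pmf.prob (pair_pmf (pmf_of_set (carrier G)) (pmf_of_set (carrier G)))
           {(x, y). f (x \<otimes> y) = circ (f x) (f y)} \<ge> 1 - \<eta>"
    and "\<And>H. subgroup H G \<Longrightarrow> H \<noteq> {\<one>} \<Longrightarrow>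
           \<exists>x\<in>H. \<exists>y\<in>H. x \<noteq> y \<and>
             measure_pmf.prob (pmf_of_set (carrier G)) {u. f (x \<otimes> u) = f (y \<otimes> u)} \<le> 1 / 2"
  shows "\<exists>(star :: 'a \<Rightarrow> 'a \<Rightarrow> 'a) (e :: 'a).
           group \<lparr>carrier = \<Gamma>, mult = star, one = e\<rparr> \<and>
           \<lparr>carrier = \<Gamma>, mult = star, one = e\<rparr> \<cong> G \<and>
           real (Ham \<Gamma> circ star) \<le> 46 * \<eta> * real (card (carrier G)) ^ 2"
proof -
  interpret group G by fact
  let ?C = "carrier G"
  let ?N = "card ?C" and ?E = "defect f circ" and ?a = "\<lambda>z. card (period_set f z)"
  note fin = \<open>finite ?C\<close>
  have N: "real ?N > 0" using fin by (auto simp: card_gt_0_iff)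
  have E: "real (card ?E) \<le> \<eta> * real ?N ^ 2"
    using assms(9) N unfolding prob_hom_eq[OF fin] by (simp add: field_simps)
  also have "\<dots> \<le> 1 / 120 * real ?N ^ 2" using assms(4) by (intro mult_right_mono) auto
  finally have E': "120 * card ?E \<le> ?N ^ 2" by (simp flip: of_nat_power)
  have "?N ^ 2 > 0" using N by simp
  with E' have "16 * card ?E < ?N ^ 2" by linarith
  then have sub: "subgroup {z \<in> ?C. ?N < 2 * ?a z} G" (is "subgroup ?K G")
    by (rule subgroup_large_period_set[OF fin])
  \<comment> \<open>For the x, y supplied by (b), the quotient \<open>y \<otimes> inv x\<close> has
    period density at most 1/2, yet it lies in the subgroup \<open>?K\<close>.\<close>
  have K: "?K = {\<one>}"
  proof (rule ccontr)
    assume "?K \<noteq> {\<one>}"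
    with assms(10)[OF sub] obtain x y where xy: "x \<in> ?K" "y \<in> ?K"
      and prob: "measure_pmf.prob (pmf_of_set ?C) {u. f (x \<otimes> u) = f (y \<otimes> u)} \<le> 1 / 2"
      by blast
    have "?C \<inter> {u. f (x \<otimes> u) = f (y \<otimes> u)} = {u \<in> ?C. f (x \<otimes> u) = f (y \<otimes> u)}" by auto
    then have "real (?a (y \<otimes> inv x)) / real ?N \<le> 1 / 2"
      using prob xy fin card_agreement_eq[OF fin, of x y f] N
      by (subst (asm) measure_pmf_of_set) auto
    then have "2 * ?a (y \<otimes> inv x) \<le> ?N" using N by (simp add: field_simps)
    moreover have "y \<otimes> inv x \<in> ?K"
      using sub xy by (meson subgroup.m_closed subgroup.m_inv_closed)
    ultimately show False by simp
  qed
  \<comment> \<open>A density between 1/3 and 1/2 would give a (N - a) at least N^2/6, whereas the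
    gap bounds it by 2 |E|, at most N^2/60. The bound 1/3 is what the injectivity argument takes as
    input.\<close>
  have small: "3 * ?a z \<le> ?N" if z: "z \<in> ?C" "z \<noteq> \<one>" for z
  proof (rule ccontr)
    assume "\<not> ?thesis"
    moreover have half: "2 * ?a z \<le> ?N" using K z by force
    ultimately have "?N * ?N \<le> (3 * ?a z) * (2 * (?N - ?a z))"
      by (intro mult_mono) auto
    also have "\<dots> = 6 * (?a z * (?N - ?a z))" by simp
    also have "\<dots> \<le> 12 * card ?E" using period_set_gap[OF fin z(1), of f circ] by simp
    finally show False using E' \<open>?N ^ 2 > 0\<close> unfolding power2_eq_square by linarith
  qed
  let ?row = "\<lambda>a. card {y \<in> ?C. (a, y) \<in> ?E}"
  define B where "B = {a \<in> ?C. ?N \<le> 3 * ?row a}"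
  have inj: "inj_on f (?C - B)"
    by (rule inj_on_subset[OF inj_on_small_row_defect[OF fin small, of circ]]) (auto simp: B_def)
  obtain g where g: "bij_betw g ?C \<Gamma>" "\<And>x. x \<in> ?C - B \<Longrightarrow> g x = f x"
    using bij_betw_extending_inj_on[OF fin \<open>finite \<Gamma>\<close> assms(7,8) Diff_subset inj] by blast
  define h where "h = the_inv_into ?C g"
  let ?star = "\<lambda>p q. g (h p \<otimes> h q)"
  have "Ham \<Gamma> circ ?star \<le> card ?E + 3 * (?N * card B)"
    unfolding h_def by (rule Ham_transported_le[OF fin g]) (auto simp: B_def)
  \<comment> \<open>N |B| is at most 3 |E|, so the total is at most (1 + 3 * 3) |E|, which stays
    below the claimed 46 \<eta> N^2.\<close>
  also have "\<dots> \<le> 10 * card ?E"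
    using card_large_row_defect[OF fin, of f circ] by (simp add: B_def)
  finally have "real (Ham \<Gamma> circ ?star) \<le> 10 * real (card ?E)" by linarith
  also have "\<dots> \<le> 46 * (\<eta> * real ?N ^ 2)" using E by linarith
  finally have "real (Ham \<Gamma> circ ?star) \<le> 46 * \<eta> * real ?N ^ 2" by simp
  then show ?thesis
    using transported_group[OF g(1)] unfolding h_def by blast
qed

end
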